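(* For every $n\ge 2$, the symmetrized polydisc $\mathbb{G}_n$ is neither Gromov $c$-hyperbolic nor Gromov $k$-hyperbolic.
   Context: Let $\mathbb{D}$ be the open unit disc in $\mathbb{C}$. The symmetrized polydisc is $\mathbb{G}_n=\pi(\mathbb{D}^n)\subset\mathbb{C}^n$, where $\pi=(\pi_1,\ldots,\pi_n)$ and $\pi_k(z_1,\ldots,z_n)=\sum_{1\le j_1<\cdots<j_k\le n}z_{j_1}\cdots z_{j_k}$ for $1\le k\le n$. For a domain $D\subset\mathbb{C}^n$, the Carath\'eodory distance is $c_D(z,w)=\sup\{\tanh^{-1}|f(w)| : f:D\to\mathbb{D}\text{ holomorphic},\ f(z)=0\}$. The Lempert function is $l_D(z,w)=\inf\{\tanh^{-1}|\alpha| : \exists\,\varphi:\mathbb{D}\to D \text{ holomorphic with } \varphi(0)=z,\ \varphi(\alpha)=w\}$, and the Kobayashi distance $k_D$ is the largest pseudodistance on $D$ not exceeding $l_D$. For a metric space $(X,d)$ and $x,y,z\in X$, the Gromov product is $(x,y)_z=d(x,z)+d(z,y)-d(x,y)$. Put $S_d(p,q,x,w)=\min\{(p,x)_w,(x,q)_w\}-(p,q)_w$. The space $(X,d)$ is Gromov hyperbolic if $\sup_{p,q,x,w\in X}S_d(p,q,x,w)<\infty$. A domain $D$ is Gromov $c$-hyperbolic (resp. Gromov $k$-hyperbolic) if $(D,c_D)$ (resp. $(D,k_D)$) is Gromov hyperbolic. *)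

theory Defs
  imports "HOL-Complex_Analysis.Complex_Analysis"
begin

text \<open>
  Complex \<open>n\<close>-space is the type \<open>complex ^ 'n\<close> with \<open>n = CARD('n)\<close>. A linear order on
  the index type numbers the coordinates: the index \<open>k\<close> stands for the number
  \<open>card {..k}\<close>, which runs through \<open>1, \<dots>, n\<close>.
\<close>

definition elem_sym :: "nat \<Rightarrow> complex ^ 'n \<Rightarrow> complex" where
  "elem_sym k z = (\<Sum>J | J \<subseteq> (UNIV :: 'n set) \<and> card J = k. \<Prod>j\<in>J. z $ j)"

definition sym_map :: "complex ^ 'n::{finite,linorder} \<Rightarrow> complex ^ 'n::{finite,linorder}" where
  "sym_map z = (\<chi> k. elem_sym (card {..k}) z)"

definition sym_polydisc :: "(complex ^ 'n::{finite,linorder}) set" where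
  "sym_polydisc = sym_map ` {z. \<forall>j. z $ j \<in> ball 0 1}"

text \<open>
  Holomorphy in several variables (on open sets) is Fr\'echet differentiability with a
  complex-linear derivative; \<open>has_derivative\<close> by itself only yields real linearity.
\<close>

definition holomorphic_fun_on :: "(complex ^ 'n \<Rightarrow> complex) \<Rightarrow> (complex ^ 'n) set \<Rightarrow> bool" where
  "holomorphic_fun_on f D \<longleftrightarrow>
     (\<forall>z\<in>D. \<exists>L. (f has_derivative L) (at z within D) \<and> (\<forall>c v. L (c *s v) = c * L v))"

definition holomorphic_disc_in :: "(complex \<Rightarrow> complex ^ 'n) \<Rightarrow> (complex ^ 'n) set \<Rightarrow> bool" where
  "holomorphic_disc_in \<phi> D \<longleftrightarrow>
     (\<forall>j. (\<lambda>t. \<phi> t $ j) holomorphic_on ball 0 1) \<and> \<phi> ` ball 0 1 \<subseteq> D"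

text \<open>On a domain the set below is bounded above, so that the supremum of reals is genuine.\<close>

definition caratheodory :: "(complex ^ 'n) set \<Rightarrow> complex ^ 'n \<Rightarrow> complex ^ 'n \<Rightarrow> real" where
  "caratheodory D z w =
     Sup {artanh (cmod (f w)) | f. holomorphic_fun_on f D \<and> f ` D \<subseteq> ball 0 1 \<and> f z = 0}"

text \<open>The value is \<open>\<infinity>\<close> if there is no analytic disc through the two points.\<close>

definition lempert :: "(complex ^ 'n) set \<Rightarrow> complex ^ 'n \<Rightarrow> complex ^ 'n \<Rightarrow> ereal" where
  "lempert D z w =
     Inf {ereal (artanh (cmod \<alpha>)) | \<alpha>. \<alpha> \<in> ball 0 1 \<and>
            (\<exists>\<phi>. holomorphic_disc_in \<phi> D \<and> \<phi> 0 = z \<and> \<phi> \<alpha> = w)}"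

definition pseudodistance_on :: "'a set \<Rightarrow> ('a \<Rightarrow> 'a \<Rightarrow> real) \<Rightarrow> bool" where
  "pseudodistance_on X d \<longleftrightarrow>
     (\<forall>x\<in>X. d x x = 0) \<and>
     (\<forall>x\<in>X. \<forall>y\<in>X. 0 \<le> d x y \<and> d x y = d y x) \<and>
     (\<forall>x\<in>X. \<forall>y\<in>X. \<forall>z\<in>X. d x z \<le> d x y + d y z)"

definition below_lempert ::
    "(complex ^ 'n) set \<Rightarrow> (complex ^ 'n \<Rightarrow> complex ^ 'n \<Rightarrow> real) \<Rightarrow> bool" where
  "below_lempert D d \<longleftrightarrow> (\<forall>x\<in>D. \<forall>y\<in>D. ereal (d x y) \<le> lempert D x y)"

text \<open>
  The largest pseudodistance below the Lempert function, as a pointwise supremum; on a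
  domain it is itself such a pseudodistance, see \<open>kobayashi_greatest\<close>.
\<close>

definition kobayashi :: "(complex ^ 'n) set \<Rightarrow> complex ^ 'n \<Rightarrow> complex ^ 'n \<Rightarrow> real" where
  "kobayashi D z w = Sup {d z w | d. pseudodistance_on D d \<and> below_lempert D d}"

definition gromov_product :: "('a \<Rightarrow> 'a \<Rightarrow> real) \<Rightarrow> 'a \<Rightarrow> 'a \<Rightarrow> 'a \<Rightarrow> real" where
  "gromov_product d x y z = d x z + d z y - d x y"

definition gromov_defect :: "('a \<Rightarrow> 'a \<Rightarrow> real) \<Rightarrow> 'a \<Rightarrow> 'a \<Rightarrow> 'a \<Rightarrow> 'a \<Rightarrow> real" where
  "gromov_defect d p q x w =
     min (gromov_product d p x w) (gromov_product d x q w) - gromov_product d p q w"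

definition gromov_hyperbolic_on :: "'a set \<Rightarrow> ('a \<Rightarrow> 'a \<Rightarrow> real) \<Rightarrow> bool" where
  "gromov_hyperbolic_on X d \<longleftrightarrow>
     bdd_above {gromov_defect d p q x w | p q x w. p \<in> X \<and> q \<in> X \<and> x \<in> X \<and> w \<in> X}"

definition gromov_c_hyperbolic :: "(complex ^ 'n) set \<Rightarrow> bool" where
  "gromov_c_hyperbolic D \<longleftrightarrow> gromov_hyperbolic_on D (caratheodory D)"

definition gromov_k_hyperbolic :: "(complex ^ 'n) set \<Rightarrow> bool" where
  "gromov_k_hyperbolic D \<longleftrightarrow> gromov_hyperbolic_on D (kobayashi D)"

lemma lempert_ball_bound:
  fixes D :: "(complex ^ 'n) set"
  assumes "0 < r" "ball z r \<subseteq> D" "w \<in> ball z r"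
  shows "lempert D z w \<le> ereal (artanh (dist z w / r))"
proof (cases "w = z")
  case True
  have "holomorphic_disc_in (\<lambda>t. z) D"
    using assms by (auto simp: holomorphic_disc_in_def)
  then show ?thesis
    unfolding lempert_def using True
    by (intro Inf_lower CollectI exI[of _ 0]) auto
next
  case False
  define s where "s = dist z w / r"
  define \<phi> where "\<phi> = (\<lambda>t :: complex. \<chi> j. z $ j + t * ((w $ j - z $ j) / of_real s))"
  have s: "0 < s" "s < 1"
    using assms False by (auto simp: s_def)
  have eq: "\<phi> t = z + (t / of_real s) *s (w - z)" for t
    by (simp add: \<phi>_def vec_eq_iff right_diff_distrib diff_divide_distrib)
  have nm: "norm (c *s v) = cmod c * norm v" for c :: complex and v :: "complex ^ 'n"
    unfolding norm_vec_def by (simp add: norm_mult L2_set_right_distrib)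
  have "\<phi> t \<in> D" if "t \<in> ball 0 1" for t
  proof -
    have "dist z (\<phi> t) = cmod t * (dist z w / s)"
      unfolding eq using s by (simp add: dist_norm nm norm_divide norm_minus_commute
          del: vector_sub_rdistrib vector_ssub_ldistrib)
    also have "dist z w / s = r"
      using assms False by (simp add: s_def)
    also have "cmod t * r < r"
      using that assms by simp
    finally show ?thesis using assms by auto
  qed
  moreover have "(\<lambda>t. \<phi> t $ j) holomorphic_on ball 0 1" for j
    unfolding \<phi>_def by (auto intro!: holomorphic_intros simp: s(1) less_imp_neq)
  ultimately have "holomorphic_disc_in \<phi> D"
    by (auto simp: holomorphic_disc_in_def)
  moreover have "\<phi> 0 = z" "\<phi> (of_real s) = w"
    using s by (auto simp: eq)
  ultimately show ?thesis
    unfolding lempert_def s_def[symmetric] using s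
    by (intro Inf_lower CollectI exI[of _ "of_real s"]) auto
qed

lemma below_lempert_bounded:
  fixes D :: "(complex ^ 'n) set"
  assumes "open D" "connected D" "z \<in> D" "w \<in> D"
  shows "bdd_above {d z w | d. pseudodistance_on D d \<and> below_lempert D d}"
proof -
  let ?P = "\<lambda>w. bdd_above {d z w | d. pseudodistance_on D d \<and> below_lempert D d}"
  have local: "\<exists>r>0. ball x r \<subseteq> D \<and> (\<forall>y\<in>ball x r. ?P x \<longleftrightarrow> ?P y)" if x: "x \<in> D" for x
  proof -
    obtain r where r: "0 < r" "ball x r \<subseteq> D"
      using \<open>open D\<close> x openE by blast
    have "?P x \<longleftrightarrow> ?P y" if y: "y \<in> ball x r" for y
    proof -
      define C where "C = artanh (dist x y / r)"
      have dC: "d x y \<le> C \<and> d y x \<le> C" if "pseudodistance_on D d" "below_lempert D d" for d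
      proof -
        have "ereal (d x y) \<le> ereal C"
          using that(2) lempert_ball_bound[OF r y] x y r unfolding below_lempert_def C_def
          by (meson order_trans subsetD)
        then show ?thesis
          using that(1) x y r unfolding pseudodistance_on_def by (metis ereal_less_eq(3) subsetD)
      qed
      have tri: "d z y \<le> d z x + C \<and> d z x \<le> d z y + C"
        if "pseudodistance_on D d" "below_lempert D d" for d
      proof -
        have "d z y \<le> d z x + d x y" "d z x \<le> d z y + d y x"
          using that(1) x y r \<open>z \<in> D\<close> unfolding pseudodistance_on_def by (meson subsetD)+
        then show ?thesis using dC[OF that] by linarith
      qed
      show ?thesis
      proof
        assume "?P x"
        then obtain B where B: "\<And>d. pseudodistance_on D d \<Longrightarrow> below_lempert D d \<Longrightarrow> d z x \<le> B"
          by (auto simp: bdd_above_def)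
        show "?P y"
          by (rule bdd_aboveI[of _ "B + C"]) (use B tri in \<open>fastforce\<close>)
      next
        assume "?P y"
        then obtain B where B: "\<And>d. pseudodistance_on D d \<Longrightarrow> below_lempert D d \<Longrightarrow> d z y \<le> B"
          by (auto simp: bdd_above_def)
        show "?P x"
          by (rule bdd_aboveI[of _ "B + C"]) (use B tri in \<open>fastforce\<close>)
      qed
    qed
    with r show ?thesis by (intro exI[of _ r] conjI ballI)
  qed
  have "?P z"
    using \<open>z \<in> D\<close> by (intro bdd_aboveI[of _ 0]) (auto simp: pseudodistance_on_def)
  have "?P z = ?P w"
  proof (rule connected_local_const[OF \<open>connected D\<close> \<open>z \<in> D\<close> \<open>w \<in> D\<close>], intro ballI)
    fix x assume x: "x \<in> D"
    from local[OF x] obtain r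
      where r: "0 < r" "ball x r \<subseteq> D" "\<forall>y\<in>ball x r. ?P x \<longleftrightarrow> ?P y"
      by (elim exE conjE)
    show "\<forall>\<^sub>F y in at x within D. ?P x = ?P y"
      unfolding eventually_at
    proof (intro exI[of _ r] conjI ballI impI)
      fix y assume "y \<in> D" "y \<noteq> x \<and> dist y x < r"
      then have "y \<in> ball x r" by (simp add: dist_commute)
      with r(3) show "?P x = ?P y" by (rule bspec)
    qed (rule r(1))
  qed
  with \<open>?P z\<close> show ?thesis by (rule iffD1[rotated])
qed

lemma kobayashi_greatest:
  fixes D :: "(complex ^ 'n) set"
  assumes "open D" "connected D"
  shows "pseudodistance_on D (kobayashi D)"
    and "below_lempert D (kobayashi D)"
    and "\<lbrakk>pseudodistance_on D d; below_lempert D d; z \<in> D; w \<in> D\<rbrakk> \<Longrightarrow> d z w \<le> kobayashi D z w"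
proof -
  let ?A = "{d. pseudodistance_on D d \<and> below_lempert D d}"
  have upper: "d z w \<le> kobayashi D z w" if "d \<in> ?A" "z \<in> D" "w \<in> D" for d z w
    unfolding kobayashi_def
    by (rule cSup_upper) (use that below_lempert_bounded[OF assms] in auto)
  have artanh_nonneg: "0 \<le> artanh x" if "0 \<le> x" "x < 1" for x :: real
    using that by (simp add: artanh_def)
  have zero: "(\<lambda>_ _. 0) \<in> ?A"
    by (auto simp: pseudodistance_on_def below_lempert_def lempert_def le_Inf_iff artanh_nonneg)
  have least: "kobayashi D z w \<le> b" if "\<And>d. d \<in> ?A \<Longrightarrow> d z w \<le> b" for z w b
    unfolding kobayashi_def
    by (rule cSup_least) (use that zero in auto)
  show "d z w \<le> kobayashi D z w"
    if "pseudodistance_on D d" "below_lempert D d" "z \<in> D" "w \<in> D" for d z w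
    using upper that by auto
  show "pseudodistance_on D (kobayashi D)"
    unfolding pseudodistance_on_def
  proof (intro conjI ballI)
    fix x assume x: "x \<in> D"
    show "kobayashi D x x = 0"
      using x upper[OF zero x x] least[of x x 0] by (force simp: pseudodistance_on_def)
  next
    fix x y assume xy: "x \<in> D" "y \<in> D"
    show "0 \<le> kobayashi D x y"
      using upper[OF zero xy] .
    have "kobayashi D a b \<le> kobayashi D b a" if "a \<in> D" "b \<in> D" for a b
    proof (rule least)
      fix d assume "d \<in> ?A"
      then show "d a b \<le> kobayashi D b a"
        using upper[of d b a] that by (auto simp: pseudodistance_on_def)
    qed
    then show "kobayashi D x y = kobayashi D y x"
      using xy by (simp add: antisym)
  next
    fix x y z assume xyz: "x \<in> D" "y \<in> D" "z \<in> D"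
    show "kobayashi D x z \<le> kobayashi D x y + kobayashi D y z"
    proof (rule least)
      fix d assume d: "d \<in> ?A"
      then have "d x z \<le> d x y + d y z"
        using xyz by (auto simp: pseudodistance_on_def)
      then show "d x z \<le> kobayashi D x y + kobayashi D y z"
        using upper[OF d xyz(1,2)] upper[OF d xyz(2,3)] by linarith
    qed
  qed
  show "below_lempert D (kobayashi D)"
    unfolding below_lempert_def
  proof (intro ballI)
    fix x y assume xy: "x \<in> D" "y \<in> D"
    show "ereal (kobayashi D x y) \<le> lempert D x y"
    proof (cases "lempert D x y")
      case (real b)
      have "kobayashi D x y \<le> b"
        by (rule least) (use real xy in \<open>force simp: below_lempert_def\<close>)
      then show ?thesis using real by simp
    next
      case PInf
      then show ?thesis by simp
    next
      case MInf
      then show ?thesis using zero xy by (force simp: below_lempert_def)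
    qed
  qed
qed

end

theory Submission
  imports Defs
begin

text \<open>
  Near \<open>\<pi>(1, -1, 0, \<dots>, 0)\<close> two coordinates of the polydisc can be told apart after symmetrization,
  and \<open>G\<^sub>n\<close> contains what is, up to bounded errors, a quadrant of the plane with the maximum metric.
  Such a quadrant contains large squares each of whose diagonals is as long as two sides together,
  and these violate the four-point condition.

  In detail, write a point of the disc as the Cayley transform \<open>(a - 1) / (a + 1)\<close> of a point \<open>a\<close> of the
  right half-plane, and consider \<open>P(a, b) = \<pi>(z)\<close>, where \<open>z\<close> has one coordinate \<open>(a - 1) / (a + 1)\<close>,
  another \<open>- (b - 1) / (b + 1)\<close>, and zeros elsewhere, with real \<open>a, b \<ge> 1\<close>.

  Upper bounds. The polydisc gives analytic discs, so multiplying or dividing each of \<open>a\<close> and \<open>b\<close> by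
  \<open>A\<close> moves \<open>P(a, b)\<close> by at most \<open>ln A / 2\<close> in both distances (\<open>quadrant_pts_disc\<close>).

  Lower bounds. For \<open>\<bar>\<sigma>\<bar> \<le> 1\<close> the symmetric function \<open>\<Sum>\<^sub>j (1 + \<sigma> z\<^sub>j) / (1 - \<sigma> z\<^sub>j)\<close> has positive real part,
  and it is a rational function of \<open>\<pi>(z)\<close>: expanding \<open>\<Prod>\<^sub>j (1 - \<sigma> z\<^sub>j)\<close> and its logarithmic derivative
  expresses it through the elementary symmetric functions (\<open>cayley_sum_sym_map\<close>). At \<open>P(a, b)\<close> it is
  \<open>a + 1 / b + (n - 2)\<close> for \<open>\<sigma> = 1\<close> and \<open>1 / a + b + (n - 2)\<close> for \<open>\<sigma> = -1\<close>, hence it sees \<open>a\<close>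
  and \<open>b\<close> separately up to bounded factors. By the Schwarz lemma, a holomorphic function \<open>h\<close> with
  positive real part gives \<open>\<bar>ln (Re h(w) / Re h(z))\<bar> / 2\<close> as a lower bound for either distance
  (\<open>caratheodory_ge_log_Re_dist\<close>, \<open>kobayashi_ge_log_Re_dist\<close>).

  For the square \<open>P(1, A)\<close>, \<open>P(A, A\<^sup>2)\<close>, \<open>P(A\<^sup>2, A)\<close>, \<open>P(A, 1)\<close> the sides are at most \<open>ln A / 2\<close> and
  the diagonals at least \<open>ln A - ln n / 2\<close>, so the defect is at least \<open>ln A - ln n\<close>. The argument
  uses only the two bounds, and therefore treats both distances at once
  (\<open>not_gromov_hyperbolic_between\<close>).
\<close>

section \<open>Distances of the right half-plane\<close>

lemma artanh_mono:
  fixes x y :: real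
  assumes "0 \<le> x" "x \<le> y" "y < 1"
  shows "artanh x \<le> artanh y"
proof -
  have "(1 + x) / (1 - x) \<le> (1 + y) / (1 - y)"
    using assms by (intro frac_le) auto
  moreover have "0 < (1 + x) / (1 - x)"
    using assms by simp
  ultimately show ?thesis
    unfolding artanh_def by (simp add: ln_mono)
qed

lemma cayley_inverse:
  fixes c :: "'a :: field_char_0"
  assumes "c + 1 \<noteq> 0"
  shows "(1 + (c - 1) / (c + 1)) / (1 - (c - 1) / (c + 1)) = c"
    and "(1 - (c - 1) / (c + 1)) / (1 + (c - 1) / (c + 1)) = 1 / c"
proof -
  have "1 + (c - 1) / (c + 1) = 2 * c / (c + 1)" "1 - (c - 1) / (c + 1) = 2 / (c + 1)"
    using assms by (simp_all add: field_simps)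
  then show *: "(1 + (c - 1) / (c + 1)) / (1 - (c - 1) / (c + 1)) = c"
    using assms by simp
  have "(1 - x) / (1 + x) = 1 / ((1 + x) / (1 - x))" for x :: 'a
    by simp
  then show "(1 - (c - 1) / (c + 1)) / (1 + (c - 1) / (c + 1)) = 1 / c"
    by (simp only: *)
qed

lemma artanh_cayley:
  fixes A :: real
  assumes "0 < A"
  shows "artanh ((A - 1) / (A + 1)) = ln A / 2"
  using assms by (simp only: artanh_def cayley_inverse)

text \<open>
  For fixed \<open>a\<close> the map \<open>b \<mapsto> (b - a) / (b + cnj a)\<close> is the conformal map of the right half-plane onto
  the disc that sends \<open>a\<close> to \<open>0\<close>; the point \<open>b\<close> is closer to \<open>a\<close> than to its mirror image.
\<close>

lemma cmod_half_plane_automorphism_less_1: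
  assumes "0 < Re a" "0 < Re b"
  shows "cmod ((b - a) / (b + cnj a)) < 1"
proof -
  have "(cmod (b - a))\<^sup>2 < (cmod (b + cnj a))\<^sup>2"
    using mult_pos_pos[OF assms] by (simp add: cmod_power2) (simp add: power2_eq_square algebra_simps)
  then have "cmod (b - a) < cmod (b + cnj a)"
    by (rule power2_less_imp_less) simp
  moreover have "0 < cmod (b + cnj a)"
    using calculation norm_ge_zero[of "b - a"] by linarith
  ultimately show ?thesis
    by (simp only: norm_divide divide_less_eq_1_pos)
qed

text \<open>
  The right-hand side is the hyperbolic distance of \<open>a\<close> and \<open>b\<close>. For fixed real parts it is smallest
  when the imaginary parts agree, and then it equals the left-hand side.
\<close>

lemma half_plane_log_Re_le_artanh:
  assumes "0 < Re a" "0 < Re b"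
  shows "\<bar>ln (Re b) - ln (Re a)\<bar> / 2 \<le> artanh (cmod ((b - a) / (b + cnj a)))"
proof -
  define x y m where "x = Re a" and "y = Re b" and "m = Im b - Im a"
  have xy: "0 < x" "0 < y" using assms by (simp_all add: x_def y_def)
  define r where "r = \<bar>y - x\<bar> / (y + x)"
  have "\<bar>ln y - ln x\<bar> / 2 = artanh r"
  proof (cases "x \<le> y")
    case True
    have "r = (y / x - 1) / (y / x + 1)"
      using True xy by (simp add: r_def divide_simps)
    then have "artanh r = ln (y / x) / 2" using xy by (simp only: artanh_cayley divide_pos_pos)
    then show ?thesis using True xy by (simp add: ln_div)
  next
    case False
    have "r = (x / y - 1) / (x / y + 1)"
      using False xy by (simp add: r_def divide_simps)
    then have "artanh r = ln (x / y) / 2" using xy by (simp only: artanh_cayley divide_pos_pos)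
    then show ?thesis using False xy by (simp add: ln_div)
  qed
  also have "\<dots> \<le> artanh (cmod ((b - a) / (b + cnj a)))"
  proof (rule artanh_mono)
    show "0 \<le> r" using xy by (simp add: r_def)
    \<comment> \<open>adding the same number to numerator and denominator of a fraction below \<open>1\<close> increases it\<close>
    have "(y - x)\<^sup>2 / (y + x)\<^sup>2 \<le> ((y - x)\<^sup>2 + m\<^sup>2) / ((y + x)\<^sup>2 + m\<^sup>2)"
    proof -
      have "(y - x)\<^sup>2 \<le> (y + x)\<^sup>2" using mult_pos_pos[OF xy] by (simp add: power2_eq_square algebra_simps)
      then have "(y - x)\<^sup>2 * m\<^sup>2 \<le> (y + x)\<^sup>2 * m\<^sup>2" by (rule mult_right_mono) simp
      then have "(y - x)\<^sup>2 * ((y + x)\<^sup>2 + m\<^sup>2) \<le> ((y - x)\<^sup>2 + m\<^sup>2) * (y + x)\<^sup>2"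
        by (simp only: distrib_left distrib_right) (simp only: ac_simps add_left_mono)
      moreover have "0 < (y + x)\<^sup>2" "0 < (y + x)\<^sup>2 + m\<^sup>2"
        using xy by (auto intro: add_pos_nonneg)
      ultimately show ?thesis by (simp only: pos_divide_le_eq pos_le_divide_eq times_divide_eq_left)
    qed
    also have "\<dots> = (cmod ((b - a) / (b + cnj a)))\<^sup>2"
      by (simp add: norm_divide power_divide cmod_power2 x_def y_def m_def)
    finally have "r\<^sup>2 \<le> (cmod ((b - a) / (b + cnj a)))\<^sup>2"
      by (simp add: r_def power_divide)
    then show "r \<le> cmod ((b - a) / (b + cnj a))"
      by (rule power2_le_imp_le) simp
    show "cmod ((b - a) / (b + cnj a)) < 1"
      using assms by (rule cmod_half_plane_automorphism_less_1)
  qed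
  finally show ?thesis by (simp add: x_def y_def)
qed

section \<open>Holomorphic functions and analytic discs\<close>

lemma holomorphic_fun_on_const: "holomorphic_fun_on (\<lambda>z. c) D"
  unfolding holomorphic_fun_on_def by (intro ballI exI[of _ "\<lambda>v. 0"]) auto

lemma holomorphic_fun_on_component: "holomorphic_fun_on (\<lambda>z. z $ k) D"
  unfolding holomorphic_fun_on_def
  by (intro ballI exI[of _ "\<lambda>v. v $ k"])
     (auto intro: bounded_linear_imp_has_derivative)

lemma holomorphic_fun_on_add:
  assumes "holomorphic_fun_on f D" "holomorphic_fun_on g D"
  shows "holomorphic_fun_on (\<lambda>z. f z + g z) D"
  unfolding holomorphic_fun_on_def
proof
  fix z assume "z \<in> D"
  then obtain L M where
    L: "(f has_derivative L) (at z within D)" "\<And>c v. L (c *s v) = c * L v" and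
    M: "(g has_derivative M) (at z within D)" "\<And>c v. M (c *s v) = c * M v"
    using assms unfolding holomorphic_fun_on_def by metis
  show "\<exists>L. ((\<lambda>z. f z + g z) has_derivative L) (at z within D) \<and> (\<forall>c v. L (c *s v) = c * L v)"
    using L M by (intro exI[of _ "\<lambda>v. L v + M v"])
      (auto intro: has_derivative_add simp: distrib_left)
qed

lemma holomorphic_fun_on_mult:
  assumes "holomorphic_fun_on f D" "holomorphic_fun_on g D"
  shows "holomorphic_fun_on (\<lambda>z. f z * g z) D"
  unfolding holomorphic_fun_on_def
proof
  fix z assume "z \<in> D"
  then obtain L M where
    L: "(f has_derivative L) (at z within D)" "\<And>c v. L (c *s v) = c * L v" and
    M: "(g has_derivative M) (at z within D)" "\<And>c v. M (c *s v) = c * M v"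
    using assms unfolding holomorphic_fun_on_def by metis
  show "\<exists>L. ((\<lambda>z. f z * g z) has_derivative L) (at z within D) \<and> (\<forall>c v. L (c *s v) = c * L v)"
    using has_derivative_mult[OF L(1) M(1)]
    by (intro exI[of _ "\<lambda>v. f z * M v + L v * g z"] conjI) (simp_all add: L(2) M(2) algebra_simps)
qed

lemma holomorphic_fun_on_divide:
  assumes "holomorphic_fun_on f D" "holomorphic_fun_on g D" "\<And>z. z \<in> D \<Longrightarrow> g z \<noteq> 0"
  shows "holomorphic_fun_on (\<lambda>z. f z / g z) D"
  unfolding holomorphic_fun_on_def
proof
  fix z assume z: "z \<in> D"
  then obtain L M where
    L: "(f has_derivative L) (at z within D)" "\<And>c v. L (c *s v) = c * L v" and
    M: "(g has_derivative M) (at z within D)" "\<And>c v. M (c *s v) = c * M v"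
    using assms unfolding holomorphic_fun_on_def by metis
  show "\<exists>L. ((\<lambda>z. f z / g z) has_derivative L) (at z within D) \<and> (\<forall>c v. L (c *s v) = c * L v)"
    using has_derivative_divide'[OF L(1) M(1) assms(3)[OF z]]
    by (intro exI[of _ "\<lambda>v. (L v * g z - f z * M v) / (g z * g z)"] conjI allI)
       (assumption, simp add: L(2) M(2) right_diff_distrib mult_ac)
qed

lemma holomorphic_fun_on_sum:
  assumes "\<And>k. k \<in> K \<Longrightarrow> holomorphic_fun_on (f k) D"
  shows "holomorphic_fun_on (\<lambda>z. \<Sum>k\<in>K. f k z) D"
  using assms
  by (induction K rule: infinite_finite_induct)
     (auto intro: holomorphic_fun_on_const holomorphic_fun_on_add)

text \<open>
  The chain rule, with a complex-linear derivative of \<open>f\<close> making the derivative along the disc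
  complex-linear as well. This turns several-variable holomorphy into a one-variable statement.
\<close>

lemma holomorphic_fun_on_disc:
  assumes f: "holomorphic_fun_on f D" and \<phi>: "holomorphic_disc_in \<phi> D"
  shows "(\<lambda>t. f (\<phi> t)) holomorphic_on ball 0 1"
  unfolding holomorphic_on_open[OF open_ball]
proof
  fix t :: complex assume t: "t \<in> ball 0 1"
  define v where "v = (\<chi> j. deriv (\<lambda>t. \<phi> t $ j) t)"
  have comp: "((\<lambda>t. \<phi> t $ j) has_derivative (\<lambda>h. v $ j * h)) (at t)" for j
    using \<phi> t holomorphic_derivI[of "\<lambda>t. \<phi> t $ j" "ball 0 1" t]
    unfolding holomorphic_disc_in_def v_def has_field_derivative_def by simp
  have "(\<phi> has_derivative (\<lambda>h. h *s v)) (at t)"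
    unfolding has_derivative_componentwise_within[of \<phi>]
  proof
    fix b :: "complex ^ 'a" assume "b \<in> Basis"
    then obtain j u where b: "b = axis j u" by (auto simp: Basis_vec_def)
    have "((\<lambda>t. \<phi> t $ j \<bullet> u) has_derivative (\<lambda>h. (v $ j * h) \<bullet> u)) (at t)"
      by (rule has_derivative_inner_left[OF comp])
    then show "((\<lambda>t. \<phi> t \<bullet> b) has_derivative (\<lambda>h. (h *s v) \<bullet> b)) (at t)"
      by (simp add: b inner_axis mult.commute)
  qed
  then have d\<phi>: "(\<phi> has_derivative (\<lambda>h. h *s v)) (at t within ball 0 1)"
    by (rule has_derivative_at_withinI)
  have image: "\<phi> ` ball 0 1 \<subseteq> D"
    using \<phi> by (simp add: holomorphic_disc_in_def)
  then have "\<phi> t \<in> D" using t by (rule subsetD[OF _ imageI])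
  from bspec[OF f[unfolded holomorphic_fun_on_def] this] obtain L
    where L: "(f has_derivative L) (at (\<phi> t) within D)" "\<And>c v. L (c *s v) = c * L v"
    by (elim exE conjE) simp
  have "((\<lambda>t. f (\<phi> t)) has_derivative (\<lambda>h. L (h *s v))) (at t within ball 0 1)"
    by (rule has_derivative_in_compose[OF d\<phi> has_derivative_subset[OF L(1) image]])
  moreover have "(\<lambda>h. L (h *s v)) = (*) (L v)"
    by (rule ext) (simp only: L(2) mult.commute)
  ultimately have "((\<lambda>t. f (\<phi> t)) has_field_derivative L v) (at t within ball 0 1)"
    by (simp only: has_field_derivative_def)
  then have "((\<lambda>t. f (\<phi> t)) has_field_derivative L v) (at t)"
    by (simp only: at_within_open[OF t open_ball])
  then show "\<exists>f'. ((\<lambda>t. f (\<phi> t)) has_field_derivative f') (at t)"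
    by (rule exI)
qed

definition analytic_disc_joins ::
    "(complex ^ 'n) set \<Rightarrow> complex ^ 'n \<Rightarrow> complex ^ 'n \<Rightarrow> complex \<Rightarrow> bool" where
  "analytic_disc_joins D z w \<alpha> \<longleftrightarrow>
     \<alpha> \<in> ball 0 1 \<and> (\<exists>\<phi>. holomorphic_disc_in \<phi> D \<and> \<phi> 0 = z \<and> \<phi> \<alpha> = w)"

lemma schwarz_on_analytic_disc:
  assumes "analytic_disc_joins D z w \<alpha>" "holomorphic_fun_on f D" "f ` D \<subseteq> ball 0 1" "f z = 0"
  shows "cmod (f w) \<le> cmod \<alpha>"
proof -
  obtain \<phi> where \<phi>: "holomorphic_disc_in \<phi> D" "\<phi> 0 = z" "\<phi> \<alpha> = w" and \<alpha>: "cmod \<alpha> < 1"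
    using assms(1) by (auto simp: analytic_disc_joins_def)
  have "cmod (f (\<phi> \<alpha>)) \<le> cmod \<alpha>"
  proof (rule Schwarz_Lemma(1)[OF holomorphic_fun_on_disc[OF assms(2) \<phi>(1)]])
    show "cmod (f (\<phi> t)) < 1" if "cmod t < 1" for t
    proof -
      have "\<phi> t \<in> D" using \<phi>(1) that by (auto simp: holomorphic_disc_in_def)
      then show ?thesis using assms(3) by auto
    qed
  qed (use \<phi> \<alpha> assms(4) in auto)
  then show ?thesis using \<phi> by simp
qed

lemma analytic_disc_joins_imp_mem:
  assumes "analytic_disc_joins D z w \<alpha>"
  shows "z \<in> D" "w \<in> D"
  using assms by (auto simp: analytic_disc_joins_def holomorphic_disc_in_def)

section \<open>Comparison with the two distances\<close>

lemma caratheodory_candidate_le: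
  assumes "analytic_disc_joins D z w \<alpha>" "holomorphic_fun_on f D" "f ` D \<subseteq> ball 0 1" "f z = 0"
  shows "artanh (cmod (f w)) \<le> artanh (cmod \<alpha>)"
  using assms(1) schwarz_on_analytic_disc[OF assms]
  by (intro artanh_mono) (auto simp: analytic_disc_joins_def)

lemma caratheodory_le_of_disc:
  assumes "analytic_disc_joins D z w \<alpha>"
  shows "caratheodory D z w \<le> artanh (cmod \<alpha>)"
  unfolding caratheodory_def
proof (rule cSup_least)
  have "holomorphic_fun_on (\<lambda>_. 0) D \<and> (\<lambda>_. 0 :: complex) ` D \<subseteq> ball 0 1 \<and> (\<lambda>_. 0 :: complex) z = 0"
    by (auto simp: holomorphic_fun_on_const)
  then show "{artanh (cmod (f w)) |f. holomorphic_fun_on f D \<and> f ` D \<subseteq> ball 0 1 \<and> f z = 0} \<noteq> {}"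
    by blast
qed (use caratheodory_candidate_le[OF assms] in blast)

lemma pseudodistance_le_of_disc:
  assumes "analytic_disc_joins D z w \<alpha>" "below_lempert D d"
  shows "d z w \<le> artanh (cmod \<alpha>)"
proof -
  have "ereal (d z w) \<le> lempert D z w"
    using assms analytic_disc_joins_imp_mem[OF assms(1)] by (auto simp: below_lempert_def)
  also have "\<dots> \<le> ereal (artanh (cmod \<alpha>))"
    unfolding lempert_def using assms(1)
    by (intro Inf_lower CollectI exI[of _ \<alpha>]) (auto simp: analytic_disc_joins_def)
  finally show ?thesis by simp
qed

text \<open>
  Comparing only the real parts of \<open>h\<close> loses a little against pulling back the hyperbolic distance of
  the half-plane, but makes the triangle inequality that of the real line.
\<close>

definition log_Re_dist :: "(complex ^ 'n \<Rightarrow> complex) \<Rightarrow> complex ^ 'n \<Rightarrow> complex ^ 'n \<Rightarrow> real" where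
  "log_Re_dist h z w = \<bar>ln (Re (h w)) - ln (Re (h z))\<bar> / 2"

lemma half_plane_to_disc:
  assumes "holomorphic_fun_on h D" "\<And>s. s \<in> D \<Longrightarrow> 0 < Re (h s)" "0 < Re a"
  shows "holomorphic_fun_on (\<lambda>s. (h s - a) / (h s + cnj a)) D"
    and "(\<lambda>s. (h s - a) / (h s + cnj a)) ` D \<subseteq> ball 0 1"
proof -
  have "h s + cnj a \<noteq> 0" if "s \<in> D" for s
  proof
    assume "h s + cnj a = 0"
    then have "Re (h s + cnj a) = 0" by simp
    then show False using assms(2)[OF that] assms(3) by simp
  qed
  then show "holomorphic_fun_on (\<lambda>s. (h s - a) / (h s + cnj a)) D"
    using holomorphic_fun_on_add[OF assms(1) holomorphic_fun_on_const, of "- a"]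
    by (intro holomorphic_fun_on_divide holomorphic_fun_on_add[OF assms(1) holomorphic_fun_on_const])
       simp_all
  show "(\<lambda>s. (h s - a) / (h s + cnj a)) ` D \<subseteq> ball 0 1"
    using cmod_half_plane_automorphism_less_1 assms by auto
qed

text \<open>
  Composing \<open>h\<close> with the conformal map of the half-plane that sends \<open>h z\<close> to \<open>0\<close> gives a competitor
  for the Caratheodory distance. The analytic disc serves to make the supremum a genuine one.
\<close>

lemma caratheodory_ge_log_Re_dist:
  assumes "analytic_disc_joins D z w \<alpha>"
    and "holomorphic_fun_on h D" "\<And>s. s \<in> D \<Longrightarrow> 0 < Re (h s)"
  shows "log_Re_dist h z w \<le> caratheodory D z w"
proof -
  note zw = analytic_disc_joins_imp_mem[OF assms(1)]
  define f where "f = (\<lambda>s. (h s - h z) / (h s + cnj (h z)))"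
  have f: "holomorphic_fun_on f D" "f ` D \<subseteq> ball 0 1" "f z = 0"
    unfolding f_def using half_plane_to_disc[OF assms(2,3), of "h z"] assms(3) zw by auto
  have "log_Re_dist h z w \<le> artanh (cmod (f w))"
    unfolding log_Re_dist_def f_def by (intro half_plane_log_Re_le_artanh assms zw)
  also have "\<dots> \<le> caratheodory D z w"
    unfolding caratheodory_def
  proof (rule cSup_upper)
    show "bdd_above {artanh (cmod (f w)) |f. holomorphic_fun_on f D \<and> f ` D \<subseteq> ball 0 1 \<and> f z = 0}"
      by (rule bdd_aboveI[of _ "artanh (cmod \<alpha>)"])
         (use caratheodory_candidate_le[OF assms(1)] in blast)
  qed (use f in blast)
  finally show ?thesis .
qed

text \<open>
  Wherever a disc joins two points, the Caratheodory distance lies between \<open>log_Re_dist h\<close> and the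
  Lempert function; hence \<open>log_Re_dist h\<close> competes in the definition of the Kobayashi distance.
\<close>

lemma log_Re_dist_admissible:
  assumes "holomorphic_fun_on h D" "\<And>s. s \<in> D \<Longrightarrow> 0 < Re (h s)"
  shows "pseudodistance_on D (log_Re_dist h)" "below_lempert D (log_Re_dist h)"
proof -
  show "pseudodistance_on D (log_Re_dist h)"
    unfolding pseudodistance_on_def log_Re_dist_def by (auto simp: abs_minus_commute)
  have "log_Re_dist h z w \<le> artanh (cmod \<alpha>)" if "analytic_disc_joins D z w \<alpha>" for z w \<alpha>
    using caratheodory_ge_log_Re_dist[OF that assms] caratheodory_le_of_disc[OF that] by linarith
  then show "below_lempert D (log_Re_dist h)"
    unfolding below_lempert_def lempert_def analytic_disc_joins_def
    by (intro ballI Inf_greatest) (elim CollectE exE, metis ereal_less_eq(3))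
qed

lemma kobayashi_le_of_disc:
  assumes "analytic_disc_joins D z w \<alpha>"
  shows "kobayashi D z w \<le> artanh (cmod \<alpha>)"
  unfolding kobayashi_def
proof (rule cSup_least)
  show "{d z w |d. pseudodistance_on D d \<and> below_lempert D d} \<noteq> {}"
    using log_Re_dist_admissible[OF holomorphic_fun_on_const, of D 1] by auto
qed (use pseudodistance_le_of_disc[OF assms] in blast)

lemma kobayashi_ge_log_Re_dist:
  assumes "analytic_disc_joins D z w \<alpha>"
    and "holomorphic_fun_on h D" "\<And>s. s \<in> D \<Longrightarrow> 0 < Re (h s)"
  shows "log_Re_dist h z w \<le> kobayashi D z w"
  unfolding kobayashi_def
proof (rule cSup_upper)
  show "bdd_above {d z w |d. pseudodistance_on D d \<and> below_lempert D d}"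
    by (rule bdd_aboveI[of _ "artanh (cmod \<alpha>)"])
       (use pseudodistance_le_of_disc[OF assms(1)] in blast)
qed (use log_Re_dist_admissible[OF assms(2,3)] in blast)

section \<open>Symmetric half-plane functions on the symmetrized polydisc\<close>

text \<open>
  The numbering of the coordinates by the linear order of the index type, needed to translate sums
  over \<open>{1..n}\<close> into sums over coordinates.
\<close>

lemma bij_betw_card_atMost:
  "bij_betw (\<lambda>k :: 'n::{finite,linorder}. card {..k}) UNIV {1..CARD('n)}"
proof -
  have "strict_mono (\<lambda>k :: 'n. card {..k})"
    by (intro strict_monoI psubset_card_mono) auto
  then have inj: "inj (\<lambda>k :: 'n. card {..k})"
    by (rule strict_mono_imp_inj_on)
  have sub: "range (\<lambda>k :: 'n. card {..k}) \<subseteq> {1..CARD('n)}"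
  proof (clarsimp, intro conjI)
    fix k :: 'n
    have "0 < card {..k}" by (subst card_gt_0_iff) auto
    then show "Suc 0 \<le> card {..k}" by simp
    show "card {..k} \<le> CARD('n)" by (intro card_mono) auto
  qed
  have "range (\<lambda>k :: 'n. card {..k}) = {1..CARD('n)}"
    using card_image[OF inj] by (intro card_subset_eq sub) auto
  with inj show ?thesis by (simp add: bij_betw_def)
qed

text \<open>
  Grouping the subsets by cardinality: every such weighted sum is an affine function of the point
  \<open>sym_map z\<close>. The empty set accounts for the constant term.
\<close>

lemma sum_subsets_eq_sym_map:
  fixes z :: "complex ^ 'n::{finite,linorder}"
  shows "(\<Sum>J\<in>UNIV. g (card J) * (\<Prod>j\<in>J. z $ j)) = g 0 + (\<Sum>k\<in>UNIV. g (card {..k}) * sym_map z $ k)"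
proof -
  have "(\<Sum>J\<in>UNIV. g (card J) * (\<Prod>j\<in>J. z $ j))
      = (\<Sum>m\<in>{0..CARD('n)}. \<Sum>J | J \<in> UNIV \<and> card J = m. g (card J) * (\<Prod>j\<in>J. z $ j))"
    by (rule sum.group[symmetric]) (auto intro!: card_mono)
  also have "\<dots> = (\<Sum>m\<in>{0..CARD('n)}. g m * elem_sym m z)"
    by (intro sum.cong refl) (simp add: elem_sym_def sum_distrib_left)
  also have "\<dots> = g 0 * elem_sym 0 z + (\<Sum>m\<in>{1..CARD('n)}. g m * elem_sym m z)"
    by (subst sum.atLeast_Suc_atMost) auto
  also have "elem_sym 0 z = 1"
    by (simp add: elem_sym_def)
  also have "(\<Sum>m\<in>{1..CARD('n)}. g m * elem_sym m z) = (\<Sum>k\<in>UNIV. g (card {..k}) * sym_map z $ k)"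
    using sum.reindex_bij_betw[OF bij_betw_card_atMost[where 'n = 'n], of "\<lambda>m. g m * elem_sym m z"]
    by (simp add: sym_map_def)
  finally show ?thesis by simp
qed

lemma prod_one_plus_scaled:
  fixes y :: "'n::finite \<Rightarrow> complex"
  shows "(\<Prod>j\<in>UNIV. 1 + x * y j) = (\<Sum>J\<in>UNIV. x ^ card J * (\<Prod>j\<in>J. y j))"
  unfolding add.commute[of 1] by (subst prod_add) (simp_all add: prod.distrib Pow_UNIV)

text \<open>
  This is \<open>x\<close> times the derivative of both sides of \<open>prod_one_plus_scaled\<close>.
\<close>

lemma sum_card_prod:
  fixes y :: "'n::finite \<Rightarrow> complex"
  shows "(\<Sum>j\<in>UNIV. x * y j * (\<Prod>l\<in>UNIV - {j}. 1 + x * y l))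
       = (\<Sum>J\<in>UNIV. of_nat (card J) * x ^ card J * (\<Prod>j\<in>J. y j))"
proof -
  have "((\<lambda>x. \<Prod>j\<in>UNIV. 1 + x * y j) has_field_derivative
          (\<Sum>j\<in>UNIV. y j * (\<Prod>l\<in>UNIV - {j}. 1 + x * y l))) (at x)"
    by (rule has_field_derivative_prod) (auto intro!: derivative_eq_intros)
  moreover have "((\<lambda>x. \<Sum>J\<in>UNIV. x ^ card J * (\<Prod>j\<in>J. y j)) has_field_derivative
          (\<Sum>J\<in>UNIV. of_nat (card J) * x ^ (card J - 1) * (\<Prod>j\<in>J. y j))) (at x)"
    by (rule DERIV_sum) (auto intro!: derivative_eq_intros)
  ultimately have "(\<Sum>j\<in>UNIV. y j * (\<Prod>l\<in>UNIV - {j}. 1 + x * y l))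
      = (\<Sum>J\<in>UNIV. of_nat (card J) * x ^ (card J - 1) * (\<Prod>j\<in>J. y j))"
    unfolding prod_one_plus_scaled by (rule DERIV_unique)
  then have "(\<Sum>j\<in>UNIV. x * y j * (\<Prod>l\<in>UNIV - {j}. 1 + x * y l))
      = x * (\<Sum>J\<in>UNIV. of_nat (card J) * x ^ (card J - 1) * (\<Prod>j\<in>J. y j))"
    by (simp add: mult.assoc flip: sum_distrib_left)
  moreover have "x * (of_nat m * x ^ (m - 1) * p) = of_nat m * x ^ m * p" for m and p :: complex
    by (cases m) auto
  ultimately show ?thesis
    by (simp only: sum_distrib_left)
qed

text \<open>
  With \<open>Q(\<sigma>) = \<Prod>\<^sub>j (1 - \<sigma> z\<^sub>j)\<close>, the following are \<open>Q(\<sigma>)\<close> and \<open>n - 2 \<sigma> Q'(\<sigma>) / Q(\<sigma>)\<close>, written as functions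
  of \<open>s = \<pi>(z)\<close>. Since \<open>1 + 2 \<sigma> z\<^sub>j / (1 - \<sigma> z\<^sub>j) = (1 + \<sigma> z\<^sub>j) / (1 - \<sigma> z\<^sub>j)\<close>, the second one is a sum of Cayley
  transforms of the \<open>\<sigma> z\<^sub>j\<close>.
\<close>

definition sym_den :: "complex \<Rightarrow> complex ^ 'n::{finite,linorder} \<Rightarrow> complex" where
  "sym_den \<sigma> s = 1 + (\<Sum>k\<in>UNIV. (- \<sigma>) ^ card {..k} * s $ k)"

definition cayley_sum :: "complex \<Rightarrow> complex ^ 'n::{finite,linorder} \<Rightarrow> complex" where
  "cayley_sum \<sigma> s = of_nat CARD('n) +
     (- 2) * (\<Sum>k\<in>UNIV. of_nat (card {..k}) * (- \<sigma>) ^ card {..k} * s $ k) / sym_den \<sigma> s"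

lemma sym_den_sym_map: "sym_den \<sigma> (sym_map z) = (\<Prod>j\<in>UNIV. 1 - \<sigma> * z $ j)"
  using prod_one_plus_scaled[of "- \<sigma>" "\<lambda>j. z $ j"] sum_subsets_eq_sym_map[of "\<lambda>m. (- \<sigma>) ^ m" z]
  by (simp add: sym_den_def)

lemma cayley_sum_sym_map:
  fixes z :: "complex ^ 'n::{finite,linorder}"
  assumes nz: "\<And>j. 1 - \<sigma> * z $ j \<noteq> 0"
  shows "cayley_sum \<sigma> (sym_map z) = (\<Sum>j\<in>UNIV. (1 + \<sigma> * z $ j) / (1 - \<sigma> * z $ j))"
proof -
  define P where "P = (\<Prod>j\<in>UNIV. 1 - \<sigma> * z $ j)"
  have "(\<Sum>k\<in>UNIV. of_nat (card {..k}) * (- \<sigma>) ^ card {..k} * sym_map z $ k)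
      = (\<Sum>j\<in>UNIV. - \<sigma> * z $ j * (\<Prod>l\<in>UNIV - {j}. 1 - \<sigma> * z $ l))"
    using sum_card_prod[of "- \<sigma>" "\<lambda>j. z $ j"]
      sum_subsets_eq_sym_map[of "\<lambda>m. of_nat m * (- \<sigma>) ^ m" z]
    by simp
  also have "\<dots> = (\<Sum>j\<in>UNIV. P * (- (\<sigma> * z $ j) / (1 - \<sigma> * z $ j)))"
  proof (intro sum.cong refl)
    fix j
    have "P = (1 - \<sigma> * z $ j) * (\<Prod>l\<in>UNIV - {j}. 1 - \<sigma> * z $ l)"
      unfolding P_def by (rule prod.remove) auto
    then show "- \<sigma> * z $ j * (\<Prod>l\<in>UNIV - {j}. 1 - \<sigma> * z $ l)
        = P * (- (\<sigma> * z $ j) / (1 - \<sigma> * z $ j))"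
      using nz[of j] by simp
  qed
  also have "\<dots> = P * (\<Sum>j\<in>UNIV. - (\<sigma> * z $ j) / (1 - \<sigma> * z $ j))"
    by (rule sum_distrib_left[symmetric])
  finally have "cayley_sum \<sigma> (sym_map z)
      = of_nat CARD('n) + (- 2) * (\<Sum>j\<in>UNIV. - (\<sigma> * z $ j) / (1 - \<sigma> * z $ j))"
    using nz by (simp add: cayley_sum_def sym_den_sym_map flip: P_def) (simp add: P_def)
  also have "\<dots> = (\<Sum>j\<in>UNIV. 1 + (- 2) * (- (\<sigma> * z $ j) / (1 - \<sigma> * z $ j)))"
    by (simp add: sum.distrib sum_distrib_left)
  also have "\<dots> = (\<Sum>j\<in>UNIV. (1 + \<sigma> * z $ j) / (1 - \<sigma> * z $ j))"
    using nz by (intro sum.cong refl) (simp add: field_simps)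
  finally show ?thesis .
qed

lemma one_minus_mult_nonzero:
  fixes \<sigma> x :: complex
  assumes "cmod \<sigma> \<le> 1" "cmod x < 1"
  shows "1 - \<sigma> * x \<noteq> 0"
proof
  assume "1 - \<sigma> * x = 0"
  then have "cmod (\<sigma> * x) = 1" by simp
  moreover have "cmod \<sigma> * cmod x \<le> 1 * cmod x"
    using assms by (intro mult_right_mono) auto
  ultimately show False using assms by (simp add: norm_mult)
qed

lemma Re_cayley_pos:
  assumes "cmod x < 1"
  shows "0 < Re ((1 + x) / (1 - x))"
proof -
  have "Re x * Re x + Im x * Im x < 1"
    using power_strict_mono[OF assms, of 2] unfolding cmod_power2 by (simp add: power2_eq_square)
  moreover have "0 < (cmod (1 - x))\<^sup>2" using assms by auto
  ultimately show ?thesis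
    by (simp add: Re_divide' ) (simp add: Re_divide cmod_power2[symmetric] algebra_simps zero_less_divide_iff)
qed

lemma cayley_sum_holomorphic:
  assumes "cmod \<sigma> \<le> 1"
  shows "holomorphic_fun_on (cayley_sum \<sigma>) (sym_polydisc :: (complex ^ 'n::{finite,linorder}) set)"
proof -
  have "sym_den \<sigma> s \<noteq> 0" if "s \<in> sym_polydisc" for s :: "complex ^ 'n::{finite,linorder}"
    using that one_minus_mult_nonzero[OF assms] by (auto simp: sym_polydisc_def sym_den_sym_map)
  then show ?thesis
    unfolding cayley_sum_def[abs_def] sym_den_def
    by (intro holomorphic_fun_on_add holomorphic_fun_on_divide holomorphic_fun_on_mult
        holomorphic_fun_on_sum holomorphic_fun_on_const holomorphic_fun_on_component)
       (auto simp: sym_den_def)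
qed

lemma Re_cayley_sum_pos:
  fixes s :: "complex ^ 'n::{finite,linorder}"
  assumes "cmod \<sigma> \<le> 1" "s \<in> sym_polydisc"
  shows "0 < Re (cayley_sum \<sigma> s)"
proof -
  obtain z :: "complex ^ 'n::{finite,linorder}" where z: "s = sym_map z" "\<And>j. cmod (z $ j) < 1"
    using assms by (auto simp: sym_polydisc_def)
  have "cmod (\<sigma> * z $ j) < 1" for j
    using mult_right_mono[OF assms(1), of "cmod (z $ j)"] z(2)[of j] by (simp add: norm_mult)
  then have "0 < (\<Sum>j\<in>UNIV. Re ((1 + \<sigma> * z $ j) / (1 - \<sigma> * z $ j)))"
    by (intro sum_pos Re_cayley_pos) auto
  also have "\<dots> = Re (cayley_sum \<sigma> s)"
    using z one_minus_mult_nonzero[OF assms(1)] by (simp add: cayley_sum_sym_map)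
  finally show ?thesis .
qed

section \<open>A flat quadrant in the symmetrized polydisc\<close>

text \<open>
  Half-plane coordinates \<open>a\<close>, \<open>b\<close> for two coordinates of the polydisc. The sign in the second one puts
  the limit for \<open>b \<rightarrow> \<infinity>\<close> at \<open>-1\<close>, away from the limit \<open>1\<close> of the first, so that symmetrization does
  not confuse the two.
\<close>

definition quadrant_pt :: "'n \<Rightarrow> 'n \<Rightarrow> complex \<Rightarrow> complex \<Rightarrow> complex ^ 'n::{finite,linorder}" where
  "quadrant_pt i j a b =
     (\<chi> l. if l = i then (a - 1) / (a + 1) else if l = j then - ((b - 1) / (b + 1)) else 0)"

lemma cmod_cayley_less_1:
  assumes "0 < Re a"
  shows "cmod ((a - 1) / (a + 1)) < 1"
  using cmod_half_plane_automorphism_less_1[of 1 a] assms by simp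

lemma cmod_quadrant_pt_less_1:
  assumes "0 < Re a" "0 < Re b"
  shows "cmod (quadrant_pt i j a b $ l) < 1"
  using assms by (simp add: quadrant_pt_def cmod_cayley_less_1)

lemma sum_two_special:
  fixes i j :: "'n::finite" and x y :: complex
  assumes "i \<noteq> j"
  shows "(\<Sum>l\<in>UNIV. if l = i then x else if l = j then y else 1)
       = x + y + (of_nat CARD('n) - 2)"
proof -
  have "(\<Sum>l\<in>UNIV. if l = i then x else if l = j then y else 1)
      = (\<Sum>l\<in>UNIV. (if l = i then x - 1 else 0) + (if l = j then y - 1 else 0) + 1)"
    using assms by (intro sum.cong) auto
  then show ?thesis by (simp add: sum.distrib)
qed

lemma cayley_sum_quadrant_pt:
  fixes i j :: "'n::{finite,linorder}"
  assumes "i \<noteq> j" "0 < Re a" "0 < Re b"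
  shows "cayley_sum 1 (sym_map (quadrant_pt i j a b)) = a + 1 / b + (of_nat CARD('n) - 2)"
    and "cayley_sum (- 1) (sym_map (quadrant_pt i j a b)) = 1 / a + b + (of_nat CARD('n) - 2)"
proof -
  let ?z = "quadrant_pt i j a b"
  have ne: "a \<noteq> 0" "b \<noteq> 0" "a + 1 \<noteq> 0" "b + 1 \<noteq> 0"
    using assms by (auto simp: complex_eq_iff)
  have "1 - 1 * ?z $ l \<noteq> 0" for l
    using cmod_quadrant_pt_less_1[OF assms(2,3)] by (intro one_minus_mult_nonzero) auto
  then have "cayley_sum 1 (sym_map ?z) = (\<Sum>l\<in>UNIV. (1 + ?z $ l) / (1 - ?z $ l))"
    using cayley_sum_sym_map[of 1 ?z] by simp
  also have "\<dots> = (\<Sum>l\<in>UNIV. if l = i then a else if l = j then 1 / b else 1)"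
    using ne by (intro sum.cong refl) (auto simp: quadrant_pt_def cayley_inverse)
  finally show "cayley_sum 1 (sym_map ?z) = a + 1 / b + (of_nat CARD('n) - 2)"
    by (simp only: sum_two_special[OF assms(1)])
  have "1 - (- 1) * ?z $ l \<noteq> 0" for l
    using cmod_quadrant_pt_less_1[OF assms(2,3)] by (intro one_minus_mult_nonzero) auto
  then have "cayley_sum (- 1) (sym_map ?z) = (\<Sum>l\<in>UNIV. (1 - ?z $ l) / (1 + ?z $ l))"
    using cayley_sum_sym_map[of "- 1" ?z] by simp
  also have "\<dots> = (\<Sum>l\<in>UNIV. if l = i then 1 / a else if l = j then b else 1)"
    using ne by (intro sum.cong refl) (auto simp: quadrant_pt_def cayley_inverse)
  finally show "cayley_sum (- 1) (sym_map ?z) = 1 / a + b + (of_nat CARD('n) - 2)"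
    by (simp only: sum_two_special[OF assms(1)])
qed

text \<open>
  Along the disc the two half-plane coordinates are \<open>a (1 + \<sigma> t) / (1 - \<sigma> t)\<close> and
  \<open>b (1 + \<rho> t) / (1 - \<rho> t)\<close>. The real parameters decide how fast and in which direction each coordinate
  moves; at \<open>0\<close> a coordinate rests, and at \<open>1\<close> and \<open>-1\<close> it follows a geodesic disc up or down.
\<close>

lemma analytic_disc_joins_quadrant_pts:
  fixes i j :: "'n::{finite,linorder}" and a b \<sigma> \<rho> :: real and \<tau> :: complex
  assumes "0 < a" "0 < b" "\<bar>\<sigma>\<bar> \<le> 1" "\<bar>\<rho>\<bar> \<le> 1" "cmod \<tau> < 1"
  shows "analytic_disc_joins sym_polydisc (sym_map (quadrant_pt i j a b))
    (sym_map (quadrant_pt i j (a * ((1 + \<sigma> * \<tau>) / (1 - \<sigma> * \<tau>))) (b * ((1 + \<rho> * \<tau>) / (1 - \<rho> * \<tau>))))) \<tau>"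
proof -
  define \<psi> where "\<psi> = (\<lambda>t :: complex.
    quadrant_pt i j (a * ((1 + \<sigma> * t) / (1 - \<sigma> * t))) (b * ((1 + \<rho> * t) / (1 - \<rho> * t))))"
  have Re: "0 < Re (c * ((1 + s * t) / (1 - s * t)))"
    if "0 < c" "\<bar>s\<bar> \<le> 1" "cmod t < 1" for c s :: real and t :: complex
  proof -
    have "\<bar>s\<bar> * cmod t \<le> 1 * cmod t" using that by (intro mult_right_mono) auto
    then have "cmod (s * t) < 1" using that by (simp add: norm_mult)
    from Re_cayley_pos[OF this] that(1) show ?thesis
      by (simp only: Re_complex_of_real Im_complex_of_real times_complex.sel) simp
  qed
  have nz: "1 - complex_of_real s * t \<noteq> 0" if "\<bar>s\<bar> \<le> 1" "cmod t < 1" for s t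
    using one_minus_mult_nonzero[of "of_real s" t] that by simp
  have nz2: "u + 1 \<noteq> 0" if "0 < Re u" for u
    using that by (auto simp: complex_eq_iff)
  have hol: "(\<lambda>t. of_real c * ((1 + of_real s * t) / (1 - of_real s * t))) holomorphic_on ball 0 1"
    if "\<bar>s\<bar> \<le> 1" for c s
    using nz[OF that] by (intro holomorphic_intros) auto
  have "(\<lambda>t. (a * ((1 + \<sigma> * t) / (1 - \<sigma> * t)) - 1) / (a * ((1 + \<sigma> * t) / (1 - \<sigma> * t)) + 1))
      holomorphic_on ball 0 1"
    using assms by (intro holomorphic_on_minus holomorphic_on_divide holomorphic_on_diff holomorphic_on_add hol nz2 Re) auto
  moreover have "(\<lambda>t. - ((b * ((1 + \<rho> * t) / (1 - \<rho> * t)) - 1) / (b * ((1 + \<rho> * t) / (1 - \<rho> * t)) + 1)))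
      holomorphic_on ball 0 1"
    using assms by (intro holomorphic_on_minus holomorphic_on_divide holomorphic_on_diff holomorphic_on_add hol nz2 Re) auto
  ultimately have \<psi>_hol: "(\<lambda>t. \<psi> t $ l) holomorphic_on ball 0 1" for l
    unfolding \<psi>_def quadrant_pt_def by (cases "l = i"; cases "l = j") simp_all
  have "(\<lambda>t. sym_map (\<psi> t) $ k) holomorphic_on ball 0 1" for k
    unfolding sym_map_def elem_sym_def by (simp, intro holomorphic_intros \<psi>_hol)
  moreover have "sym_map (\<psi> t) \<in> sym_polydisc" if "cmod t < 1" for t
    unfolding sym_polydisc_def \<psi>_def
    using assms that by (intro imageI CollectI allI) (simp only: mem_ball_0 cmod_quadrant_pt_less_1 Re)
  ultimately have "holomorphic_disc_in (\<lambda>t. sym_map (\<psi> t)) sym_polydisc"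
    by (auto simp: holomorphic_disc_in_def)
  moreover have "\<psi> 0 = quadrant_pt i j a b" by (simp add: \<psi>_def)
  ultimately show ?thesis
    using assms(5) unfolding analytic_disc_joins_def \<psi>_def
    by (intro conjI exI[of _ "\<lambda>t. sym_map (\<psi> t)"]) (auto simp: \<psi>_def)
qed

text \<open>
  The maximum metric: both coordinates may change by the factor \<open>B\<close> at the cost of one, because one
  disc moves them simultaneously.
\<close>

lemma quadrant_pts_disc:
  fixes i j :: "'n::{finite,linorder}" and a b B :: real
  assumes "0 < a" "0 < b" "1 \<le> B" "r \<in> {1, B, 1 / B}" "s \<in> {1, B, 1 / B}"
  shows "\<exists>\<alpha>. analytic_disc_joins sym_polydisc (sym_map (quadrant_pt i j a b))
           (sym_map (quadrant_pt i j (a * r) (b * s))) \<alpha> \<and> artanh (cmod \<alpha>) = ln B / 2"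
proof -
  define \<tau> where "\<tau> = (B - 1) / (B + 1)"
  have \<tau>: "(1 + \<tau>) / (1 - \<tau>) = B" "(1 - \<tau>) / (1 + \<tau>) = 1 / B" "0 \<le> \<tau>" "\<tau> < 1"
    using assms(3) by (simp_all add: \<tau>_def cayley_inverse)
  have ratio: "\<exists>\<sigma>. \<bar>\<sigma>\<bar> \<le> 1 \<and> r = (1 + \<sigma> * \<tau>) / (1 - \<sigma> * \<tau>)" if r: "r \<in> {1, B, 1 / B}" for r
  proof -
    consider "r = 1" | "r = B" | "r = 1 / B" using r by blast
    then show ?thesis
    proof cases
      case 1 then show ?thesis by (intro exI[of _ 0]) simp
    next
      case 2 then show ?thesis using \<tau>(1) by (intro exI[of _ 1]) simp
    next
      case 3 then show ?thesis using \<tau>(2) by (intro exI[of _ "-1"]) simp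
    qed
  qed
  obtain \<sigma> where \<sigma>: "\<bar>\<sigma>\<bar> \<le> 1" "r = (1 + \<sigma> * \<tau>) / (1 - \<sigma> * \<tau>)"
    using ratio[OF assms(4)] by blast
  obtain \<rho> where \<rho>: "\<bar>\<rho>\<bar> \<le> 1" "s = (1 + \<rho> * \<tau>) / (1 - \<rho> * \<tau>)"
    using ratio[OF assms(5)] by blast
  have "analytic_disc_joins sym_polydisc (sym_map (quadrant_pt i j a b))
      (sym_map (quadrant_pt i j (a * r) (b * s))) \<tau>"
    using analytic_disc_joins_quadrant_pts[OF assms(1,2) \<sigma>(1) \<rho>(1), of \<tau> i j] \<tau>(3,4)
    by (simp add: \<sigma>(2) \<rho>(2))
  moreover have "artanh (cmod \<tau>) = ln B / 2"
    using \<tau>(3) artanh_cayley[of B] assms(3) by (simp only: norm_of_real abs_of_nonneg \<tau>_def[symmetric])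
  ultimately show ?thesis by blast
qed

section \<open>Failure of the four-point condition\<close>

text \<open>
  The defect of a quadruple is the sum of the diagonals \<open>d p q\<close> and \<open>d x w\<close> minus the larger of the two
  sums of opposite sides \<open>d p x + d w q\<close> and \<open>d x q + d p w\<close>, which is large for a square in the
  maximum metric.
\<close>

lemma not_gromov_hyperbolic_between:
  fixes d :: "complex ^ 'n::{finite,linorder} \<Rightarrow> complex ^ 'n::{finite,linorder} \<Rightarrow> real"
  assumes card: "CARD('n) \<ge> 2"
    and upper: "\<And>z w \<alpha>. analytic_disc_joins sym_polydisc z w \<alpha> \<Longrightarrow> d z w \<le> artanh (cmod \<alpha>)"
    and lower: "\<And>z w \<alpha> h. analytic_disc_joins sym_polydisc z w \<alpha> \<Longrightarrow>
      holomorphic_fun_on h sym_polydisc \<Longrightarrow> (\<And>s. s \<in> sym_polydisc \<Longrightarrow> 0 < Re (h s)) \<Longrightarrow>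
      log_Re_dist h z w \<le> d z w"
  shows "\<not> gromov_hyperbolic_on sym_polydisc d"
proof
  assume "gromov_hyperbolic_on sym_polydisc d"
  then obtain K where K: "\<And>p q x w. \<lbrakk>p \<in> sym_polydisc; q \<in> sym_polydisc; x \<in> sym_polydisc;
      w \<in> sym_polydisc\<rbrakk> \<Longrightarrow> gromov_defect d p q x w \<le> K"
    unfolding gromov_hyperbolic_on_def bdd_above_def by blast
  have "\<not> is_singleton (UNIV :: 'n set)"
    using card by (auto simp: is_singleton_altdef)
  then obtain i j :: 'n where ij: "i \<noteq> j"
    by (metis UNIV_I UNIV_eq_I insertI1 is_singletonI singletonD finite.emptyI insert_iff)
  define n where "n = real CARD('n)"
  have n: "2 \<le> n" using card by (simp add: n_def)
  \<comment> \<open>chosen such that the defect, at least \<open>ln A - ln n\<close>, exceeds \<open>K\<close>\<close>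
  define A where "A = n * exp (\<bar>K\<bar> + 1)"
  have A: "n \<le> A" "2 \<le> A" and lnA: "ln A = ln n + (\<bar>K\<bar> + 1)"
  proof -
    have "n * 1 \<le> n * exp (\<bar>K\<bar> + 1)" using n by (intro mult_left_mono) auto
    then show "n \<le> A" by (simp add: A_def)
    then show "2 \<le> A" using n by simp
    show "ln A = ln n + (\<bar>K\<bar> + 1)" using n by (simp add: A_def ln_mult)
  qed
  define P where "P = (\<lambda>(a :: real) (b :: real). sym_map (quadrant_pt i j a b))"
  \<comment> \<open>in the coordinates \<open>(ln a / ln A, ln b / ln A)\<close> these are the points
    \<open>(0,1)\<close>, \<open>(2,1)\<close>, \<open>(1,0)\<close>, \<open>(1,2)\<close>\<close>
  define p q x w where "p = P 1 A" and "q = P (A\<^sup>2) A" and "x = P A 1" and "w = P A (A\<^sup>2)"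
  note pqxw = p_def q_def x_def w_def
  have disc: "\<exists>\<alpha>. analytic_disc_joins sym_polydisc (P a b) (P (a * r) (b * s)) \<alpha> \<and> artanh (cmod \<alpha>) = ln B / 2"
    if "0 < a" "0 < b" "1 \<le> B" "r \<in> {1, B, 1 / B}" "s \<in> {1, B, 1 / B}" for a b r s B :: real
    unfolding P_def using quadrant_pts_disc[OF that] by simp
  have mem: "P a b \<in> sym_polydisc" if "0 < a" "0 < b" for a b
    unfolding P_def sym_polydisc_def
    using that cmod_quadrant_pt_less_1[of "of_real a" "of_real b" i j] by auto
  have side: "d (P a b) (P (a * r) (b * s)) \<le> ln A / 2"
    if ab: "0 < a" "0 < b" and rs: "r \<in> {A, 1 / A}" "s \<in> {A, 1 / A}" for a b r s :: real
  proof -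
    obtain \<alpha> where \<alpha>: "analytic_disc_joins sym_polydisc (P a b) (P (a * r) (b * s)) \<alpha>"
      "artanh (cmod \<alpha>) = ln A / 2"
      using disc[OF ab, of A r s] rs A by auto
    show ?thesis using upper[OF \<alpha>(1)] unfolding \<alpha>(2) .
  qed
  have sides: "d p x \<le> ln A / 2" "d w q \<le> ln A / 2" "d x q \<le> ln A / 2" "d p w \<le> ln A / 2"
    unfolding pqxw
    using side[of 1 A A "1 / A"] side[of A "A\<^sup>2" A "1 / A"] side[of A 1 A A] side[of 1 A A A] A
    by (simp_all add: power2_eq_square)
  have cs: "Re (cayley_sum 1 (P a b)) = a + 1 / b + (n - 2)"
    "Re (cayley_sum (- 1) (P a b)) = 1 / a + b + (n - 2)" if "0 < a" "0 < b" for a b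
    using cayley_sum_quadrant_pt[OF ij, of "of_real a" "of_real b"] that
    by (simp_all add: P_def n_def)
  have invA: "0 < 1 / A" "1 / A \<le> 1" using A by simp_all
  have ln_small: "ln (1 + 1 / A + (n - 2)) \<le> ln n"
    using invA n by (intro ln_mono) linarith+
  have ln_big: "2 * ln A \<le> ln (A\<^sup>2 + 1 / A + (n - 2))"
  proof -
    have "2 * ln A = ln (A\<^sup>2)" using A by (simp add: ln_realpow)
    also have "\<dots> \<le> ln (A\<^sup>2 + 1 / A + (n - 2))"
      using invA n A by (intro ln_mono) auto
    finally show ?thesis .
  qed
  have gap: "ln A - ln n / 2
      \<le> \<bar>ln (A\<^sup>2 + 1 / A + (n - 2)) - ln (1 + 1 / A + (n - 2))\<bar> / 2"
  proof -
    have "ln A - ln n / 2 = (2 * ln A - ln n) / 2"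
      by (simp add: diff_divide_distrib)
    also have "\<dots> \<le> (ln (A\<^sup>2 + 1 / A + (n - 2)) - ln (1 + 1 / A + (n - 2))) / 2"
      by (intro divide_right_mono diff_mono ln_small ln_big) simp
    also have "\<dots> \<le> \<bar>ln (A\<^sup>2 + 1 / A + (n - 2)) - ln (1 + 1 / A + (n - 2))\<bar> / 2"
      by (intro divide_right_mono abs_ge_self) simp
    finally show ?thesis .
  qed
  \<comment> \<open>the diagonals; along \<open>p q\<close> only \<open>a\<close> varies, along \<open>x w\<close> only \<open>b\<close>\<close>
  have pq: "ln A - ln n / 2 \<le> d p q"
  proof -
    have "\<exists>\<alpha>. analytic_disc_joins sym_polydisc p q \<alpha> \<and> artanh (cmod \<alpha>) = ln (A\<^sup>2) / 2"
      unfolding pqxw using A disc[of 1 A "A\<^sup>2" "A\<^sup>2" 1] by (simp add: one_le_power)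
    then obtain \<alpha> where \<alpha>: "analytic_disc_joins sym_polydisc p q \<alpha>" by blast
    have "Re (cayley_sum 1 p) = 1 + 1 / A + (n - 2)"
      "Re (cayley_sum 1 q) = A\<^sup>2 + 1 / A + (n - 2)"
      unfolding pqxw using A by (simp_all add: cs)
    then have "ln A - ln n / 2 \<le> log_Re_dist (cayley_sum 1) p q"
      unfolding log_Re_dist_def using gap by simp
    also have "\<dots> \<le> d p q"
      by (rule lower[OF \<alpha> cayley_sum_holomorphic Re_cayley_sum_pos]) simp_all
    finally show ?thesis .
  qed
  have wx: "ln A - ln n / 2 \<le> d w x" "ln A - ln n / 2 \<le> d x w"
  proof -
    have "\<exists>\<alpha>. analytic_disc_joins sym_polydisc x w \<alpha> \<and> artanh (cmod \<alpha>) = ln (A\<^sup>2) / 2"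
      unfolding pqxw using A disc[of A 1 "A\<^sup>2" 1 "A\<^sup>2"] by (simp add: one_le_power)
    then obtain \<alpha> where \<alpha>: "analytic_disc_joins sym_polydisc x w \<alpha>" by blast
    have "\<exists>\<beta>. analytic_disc_joins sym_polydisc w x \<beta> \<and> artanh (cmod \<beta>) = ln (A\<^sup>2) / 2"
      unfolding pqxw using A disc[of A "A\<^sup>2" "A\<^sup>2" 1 "1 / A\<^sup>2"] by (simp add: one_le_power)
    then obtain \<beta> where \<beta>: "analytic_disc_joins sym_polydisc w x \<beta>" by blast
    have Re: "Re (cayley_sum (- 1) x) = 1 + 1 / A + (n - 2)"
      "Re (cayley_sum (- 1) w) = A\<^sup>2 + 1 / A + (n - 2)"
      unfolding pqxw using A by (simp_all add: cs)
    have "ln A - ln n / 2 \<le> log_Re_dist (cayley_sum (- 1)) w x"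
      unfolding log_Re_dist_def Re using gap by (simp only: abs_minus_commute)
    also have "\<dots> \<le> d w x"
      by (rule lower[OF \<beta> cayley_sum_holomorphic Re_cayley_sum_pos]) simp_all
    finally show "ln A - ln n / 2 \<le> d w x" .
    have "ln A - ln n / 2 \<le> log_Re_dist (cayley_sum (- 1)) x w"
      unfolding log_Re_dist_def Re using gap .
    also have "\<dots> \<le> d x w"
      by (rule lower[OF \<alpha> cayley_sum_holomorphic Re_cayley_sum_pos]) simp_all
    finally show "ln A - ln n / 2 \<le> d x w" .
  qed
  have "ln A - ln n + gromov_product d p q w \<le> gromov_product d p x w"
    "ln A - ln n + gromov_product d p q w \<le> gromov_product d x q w"
    using sides pq wx unfolding gromov_product_def by linarith+
  then have "ln A - ln n \<le> gromov_defect d p q x w"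
    unfolding gromov_defect_def by linarith
  also have "\<dots> \<le> K"
    unfolding pqxw using A by (intro K mem) auto
  finally show False using lnA by linarith
qed

theorem proposition3:
  assumes "CARD('n::{finite,linorder}) \<ge> 2"
  shows "\<not> gromov_c_hyperbolic (sym_polydisc :: (complex ^ 'n::{finite,linorder}) set)
       \<and> \<not> gromov_k_hyperbolic (sym_polydisc :: (complex ^ 'n::{finite,linorder}) set)"
  unfolding gromov_c_hyperbolic_def gromov_k_hyperbolic_def
proof
  show "\<not> gromov_hyperbolic_on sym_polydisc (caratheodory (sym_polydisc :: (complex ^ 'n::{finite,linorder}) set))"
    by (rule not_gromov_hyperbolic_between[OF assms caratheodory_le_of_disc caratheodory_ge_log_Re_dist])
  show "\<not> gromov_hyperbolic_on sym_polydisc (kobayashi (sym_polydisc :: (complex ^ 'n::{finite,linorder}) set))"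
    by (rule not_gromov_hyperbolic_between[OF assms kobayashi_le_of_disc kobayashi_ge_log_Re_dist])
qed

end
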